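(* Let $F$ be a field and let $L=\{\alpha_1,\dotsc,\alpha_k\}\subset F$ be a set of $k$ distinct elements with $0\notin L$. Suppose $r,l,v$ are positive integers. If $N(r-1,L)\geq\binom{r+l-1}{l}+v$, then there exists a $k$-variable homogeneous polynomial $P$ with integer coefficients that satisfies the following: (1) $P(1,\dotsc,1)=1$; (2) for every univariate polynomial $f\in F[x]$ of degree at most $l$ with $f(0)=0$, the polynomial $P$ vanishes at the point $\bigl(f(\alpha_1),\dotsc,f(\alpha_k)\bigr)$ to order at least $v$; (3) $\deg P\leq\binom{r+l-1}{l}+v$.
   Context: For a subset $L$ of a field $F$, an $L$-matrix is a square matrix over $F$ whose diagonal entries are all $0$ and each of whose off-diagonal entries belongs to $L$. $N(r,L)$ is the maximum $n$ such that there exists an $n\times n$ $L$-matrix of rank at most $r$. A multivariate polynomial $P$ vanishes to order (at least) $m$ at a point $\beta\in F^k$ if all monomials of degree at most $m-1$ in the polynomial $P(x+\beta)$ have zero coefficients in $F$; here integer coefficients are mapped into $F$ via $\mathbb{Z}\to F$. *)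

theory Defs
  imports
    "HOL-Library.Poly_Mapping"
    "HOL-Library.Extended_Nat"
    "HOL-Computational_Algebra.Polynomial"
    "Jordan_Normal_Form.DL_Rank"
begin

definition L_matrix :: "'a::field set \<Rightarrow> nat \<Rightarrow> 'a mat \<Rightarrow> bool" where
  "L_matrix L n M \<longleftrightarrow> M \<in> carrier_mat n n \<and> (\<forall>i<n. M $$ (i, i) = 0) \<and>
    (\<forall>i<n. \<forall>j<n. i \<noteq> j \<longrightarrow> M $$ (i, j) \<in> L)"

definition L_matrix_sizes :: "nat \<Rightarrow> 'a::field set \<Rightarrow> nat set" where
  "L_matrix_sizes r L = {n. \<exists>M. L_matrix L n M \<and> vec_space.rank n M \<le> r}"

text \<open>The supremum is taken in the extended naturals, so that it is \<open>\<infinity>\<close> if arbitrarily large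
  such matrices exist; otherwise it is the maximum, as the lemma below confirms.\<close>

definition N :: "nat \<Rightarrow> 'a::field set \<Rightarrow> enat" where
  "N r L = (SUP n \<in> L_matrix_sizes r L. enat n)"

lemma N_eq_enat_iff:
  "N r L = enat n \<longleftrightarrow> n \<in> L_matrix_sizes r L \<and> (\<forall>m \<in> L_matrix_sizes r L. m \<le> n)"
proof
  assume N: "N r L = enat n"
  have le: "\<forall>m \<in> L_matrix_sizes r L. m \<le> n"
    by (metis N N_def SUP_upper enat_ord_simps(1))
  have fin: "finite (L_matrix_sizes r L)"
    using le by (auto simp: finite_nat_set_iff_bounded_le)
  have "L_matrix L 0 (0\<^sub>m 0 0)"
    by (simp add: L_matrix_def)
  moreover have "vec_space.rank 0 (0\<^sub>m 0 0 :: 'a mat) \<le> r"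
    using vec_space.rank_le_nc[of "0\<^sub>m 0 0 :: 'a mat" 0 0] by simp
  ultimately have ne: "L_matrix_sizes r L \<noteq> {}"
    by (auto simp: L_matrix_sizes_def)
  have "enat n \<in> enat ` L_matrix_sizes r L"
    using N fin ne unfolding N_def
    by (metis Max_Sup Max_in finite_imageI image_is_empty)
  then show "n \<in> L_matrix_sizes r L \<and> (\<forall>m \<in> L_matrix_sizes r L. m \<le> n)"
    using le by auto
next
  assume "n \<in> L_matrix_sizes r L \<and> (\<forall>m \<in> L_matrix_sizes r L. m \<le> n)"
  then show "N r L = enat n"
    unfolding N_def by (intro antisym SUP_least SUP_upper) auto
qed

text \<open>Multivariate polynomials, with variables indexed by the natural numbers, are finitely supported
  maps from monomials (exponent vectors) to coefficients. The ring operations are those of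
  \<^theory>\<open>HOL-Library.Poly_Mapping\<close>; the constant polynomial \<open>c\<close> is \<open>Poly_Mapping.single 0 c\<close>.\<close>

type_synonym 'a mpoly = "(nat \<Rightarrow>\<^sub>0 nat) \<Rightarrow>\<^sub>0 'a"

definition mdeg :: "(nat \<Rightarrow>\<^sub>0 nat) \<Rightarrow> nat" where
  "mdeg m = (\<Sum>i \<in> Poly_Mapping.keys m. Poly_Mapping.lookup m i)"

definition mpoly_vars :: "'a::zero mpoly \<Rightarrow> nat set" where
  "mpoly_vars P = (\<Union>m \<in> Poly_Mapping.keys P. Poly_Mapping.keys m)"

definition total_deg :: "'a::zero mpoly \<Rightarrow> nat" where
  "total_deg P = Max (insert 0 (mdeg ` Poly_Mapping.keys P))"

definition homogeneous :: "'a::zero mpoly \<Rightarrow> bool" where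
  "homogeneous P \<longleftrightarrow> (\<exists>d. \<forall>m \<in> Poly_Mapping.keys P. mdeg m = d)"

definition mpoly_eval :: "(nat \<Rightarrow> 'a) \<Rightarrow> 'a::comm_ring_1 mpoly \<Rightarrow> 'a" where
  "mpoly_eval x P = (\<Sum>m \<in> Poly_Mapping.keys P.
     Poly_Mapping.lookup P m * (\<Prod>i \<in> Poly_Mapping.keys m. x i ^ Poly_Mapping.lookup m i))"

text \<open>The polynomial \<open>P(x + \<beta>)\<close>: each variable \<open>x\<^sub>i\<close> is replaced by \<open>x\<^sub>i + \<beta>\<^sub>i\<close>.\<close>

definition mpoly_shift :: "(nat \<Rightarrow> 'a) \<Rightarrow> 'a::comm_ring_1 mpoly \<Rightarrow> 'a mpoly" where
  "mpoly_shift \<beta> P = (\<Sum>m \<in> Poly_Mapping.keys P.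
     Poly_Mapping.single 0 (Poly_Mapping.lookup P m) *
     (\<Prod>i \<in> Poly_Mapping.keys m.
        (Poly_Mapping.single (Poly_Mapping.single i 1) 1 + Poly_Mapping.single 0 (\<beta> i))
          ^ Poly_Mapping.lookup m i))"

text \<open>The bound \<open>mdeg m < v\<close> says degree at most \<open>v - 1\<close>, without truncated subtraction at \<open>v = 0\<close>.\<close>

definition vanishes_to_order :: "nat \<Rightarrow> (nat \<Rightarrow> 'a) \<Rightarrow> 'a::comm_ring_1 mpoly \<Rightarrow> bool" where
  "vanishes_to_order v \<beta> P \<longleftrightarrow>
     (\<forall>m. mdeg m < v \<longrightarrow> Poly_Mapping.lookup (mpoly_shift \<beta> P) m = 0)"

end

theory Submission
  imports Defs
begin

text \<open>Let \<open>n = (r + l - 1 choose l) + v\<close> and take an \<open>n \<times> n\<close> \<open>L\<close>-matrix \<open>M\<close> of rank at most \<open>r - 1\<close>.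
  Replace every off-diagonal entry \<open>\<alpha>\<^sub>c\<close> by the variable \<open>x\<^sub>c\<close> and the last diagonal entry by \<open>x\<^sub>1\<close>;
  up to sign, \<open>P\<close> is the determinant of this matrix. At \<open>(1, \<dots>, 1)\<close> it is the determinant of the
  all-ones matrix minus \<open>diag (1, \<dots>, 1, 0)\<close>, which is \<open>\<plusminus>1\<close> thanks to the corner entry. At
  \<open>(f \<alpha>\<^sub>1, \<dots>, f \<alpha>\<^sub>k)\<close> the matrix is \<open>f\<close> applied entrywise to \<open>M = U W\<close>, plus a rank one corner. As
  \<open>f\<close> has no constant term, the entries of the former are combinations of the
  \<open>(r + l - 1 choose l) - 1\<close> nonconstant monomials of degree at most \<open>l\<close> in the \<open>r - 1\<close> products
  \<open>u\<^sub>i\<^sub>x w\<^sub>x\<^sub>j\<close>. So the total rank is at most \<open>n - v\<close>, and the determinant of a constant matrix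
  of corank at least \<open>v\<close> plus a matrix of linear forms has no terms of degree below \<open>v\<close>.\<close>

subsection \<open>Evaluation and shift as ring homomorphisms\<close>

lemma poly_mapping_single_induct [case_names zero single_add]:
  fixes p :: "'a \<Rightarrow>\<^sub>0 'b::comm_monoid_add"
  assumes "P 0" and "\<And>a b f. P f \<Longrightarrow> P (Poly_Mapping.single a b + f)"
  shows "P p"
proof (induction p rule: Poly_Mapping.update_induct)
  case const
  show ?case by fact
next
  case (update f a b)
  have "Poly_Mapping.update a b f = Poly_Mapping.single a b + f"
    using update(1) by (intro poly_mapping_eqI)
      (auto simp: lookup_update lookup_add lookup_single when_def in_keys_iff)
  then show ?case using assms(2)[OF update(3)] by simp
qed

text \<open>Both sides are additive in each argument, so agreement on single terms suffices.\<close>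

lemma additive_imp_multiplicative:
  fixes T :: "('a::monoid_add \<Rightarrow>\<^sub>0 'b::semiring_0) \<Rightarrow> 'c::ring"
  assumes add: "\<And>p q. T (p + q) = T p + T q"
    and single: "\<And>a b x y. T (Poly_Mapping.single a x * Poly_Mapping.single b y)
      = T (Poly_Mapping.single a x) * T (Poly_Mapping.single b y)"
  shows "T (p * q) = T p * T q"
proof -
  have 0: "T 0 = 0" using add[of 0 0] by simp
  have "T (Poly_Mapping.single a x * q) = T (Poly_Mapping.single a x) * T q" for a x
    by (induction q rule: poly_mapping_single_induct) (simp_all add: 0 add single distrib_left)
  then show ?thesis
    by (induction p rule: poly_mapping_single_induct) (simp_all add: 0 add distrib_right)
qed

lemma comm_ring_hom_map:
  assumes "comm_ring_hom (h :: 'b::comm_ring_1 \<Rightarrow> 'c::comm_ring_1)"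
  shows "comm_ring_hom (Poly_Mapping.map h :: ('a::comm_monoid_add \<Rightarrow>\<^sub>0 'b) \<Rightarrow> _)"
proof -
  interpret comm_ring_hom h by fact
  let ?H = "Poly_Mapping.map h :: ('a \<Rightarrow>\<^sub>0 'b) \<Rightarrow> _"
  have add: "?H (p + q) = ?H p + ?H q" for p q
    \<comment> \<open>\<open>Poly_Mapping.map\<close> fixes the value 0 off the support of its
      argument; where the supports of \<open>p\<close>, \<open>q\<close> and \<open>p + q\<close>
      differ, this has to be matched with \<open>h 0 = 0\<close>.\<close>
    by (rule poly_mapping_eqI)
      (simp add: Poly_Mapping.map.rep_eq lookup_add when_def hom_distribs, metis hom_zero hom_add)
  have "?H (p * q) = ?H p * ?H q" for p q
    by (rule additive_imp_multiplicative) (simp_all add: add mult_single hom_distribs)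
  moreover have "?H (Poly_Mapping.single 0 1) = Poly_Mapping.single 0 (h 1)"
    by (rule Poly_Mapping.map_single) simp
  ultimately show ?thesis
    by unfold_locales (simp_all add: add Poly_Mapping.map_eq_zero_iff)
qed

definition monom_val :: "('v \<Rightarrow> 'a::comm_semiring_1) \<Rightarrow> ('v \<Rightarrow>\<^sub>0 nat) \<Rightarrow> 'a" where
  "monom_val \<psi> m = (\<Prod>i \<in> Poly_Mapping.keys m. \<psi> i ^ Poly_Mapping.lookup m i)"

text \<open>Common form of evaluation and shift: \<open>\<phi>\<close> acts on the coefficients and
  \<open>\<psi>\<close> replaces the variables, so one homomorphism proof covers both.\<close>

definition mpoly_subst :: "('a \<Rightarrow> 'b) \<Rightarrow> ('v \<Rightarrow> 'b) \<Rightarrow> (('v \<Rightarrow>\<^sub>0 nat) \<Rightarrow>\<^sub>0 'a::zero) \<Rightarrow> 'b::comm_semiring_1"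
  where "mpoly_subst \<phi> \<psi> p
    = (\<Sum>m \<in> Poly_Mapping.keys p. \<phi> (Poly_Mapping.lookup p m) * monom_val \<psi> m)"

lemma monom_val_superset:
  assumes "finite S" "Poly_Mapping.keys m \<subseteq> S"
  shows "monom_val \<psi> m = (\<Prod>i \<in> S. \<psi> i ^ Poly_Mapping.lookup m i)"
  unfolding monom_val_def
  by (rule prod.mono_neutral_left) (use assms in \<open>auto simp: in_keys_iff\<close>)

lemma monom_val_add: "monom_val \<psi> (m + m') = monom_val \<psi> m * monom_val \<psi> m'"
  using Poly_Mapping.keys_add[of m m']
  by (simp add: monom_val_superset[of "Poly_Mapping.keys m \<union> Poly_Mapping.keys m'"]
      lookup_add power_add prod.distrib)

lemma monom_val_0 [simp]: "monom_val \<psi> 0 = 1"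
  by (simp add: monom_val_def)

lemma monom_val_var [simp]: "monom_val \<psi> (Poly_Mapping.single i 1) = \<psi> i"
  by (simp add: monom_val_def)

context comm_ring_hom
begin

lemma mpoly_subst_superset:
  assumes "finite S" "Poly_Mapping.keys p \<subseteq> S"
  shows "mpoly_subst hom \<psi> p = (\<Sum>m \<in> S. hom (Poly_Mapping.lookup p m) * monom_val \<psi> m)"
  unfolding mpoly_subst_def
  by (rule sum.mono_neutral_left) (use assms in \<open>auto simp: in_keys_iff\<close>)

lemma mpoly_subst_single: "mpoly_subst hom \<psi> (Poly_Mapping.single m c) = hom c * monom_val \<psi> m"
  by (simp add: mpoly_subst_superset[of "{m}"])

lemma mpoly_subst_add: "mpoly_subst hom \<psi> (p + q) = mpoly_subst hom \<psi> p + mpoly_subst hom \<psi> q"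
  using Poly_Mapping.keys_add[of p q]
  by (simp add: mpoly_subst_superset[of "Poly_Mapping.keys p \<union> Poly_Mapping.keys q"]
      lookup_add hom_distribs distrib_right sum.distrib)

lemma comm_ring_hom_mpoly_subst: "comm_ring_hom (mpoly_subst hom \<psi>)"
proof -
  have "mpoly_subst hom \<psi> (p * q) = mpoly_subst hom \<psi> p * mpoly_subst hom \<psi> q" for p q
    by (rule additive_imp_multiplicative)
      (simp_all add: mpoly_subst_add mpoly_subst_single mult_single hom_distribs monom_val_add ac_simps)
  moreover have "mpoly_subst hom \<psi> 1 = 1"
    unfolding single_one[symmetric] mpoly_subst_single by simp
  moreover have "mpoly_subst hom \<psi> 0 = 0"
    by (simp add: mpoly_subst_def)
  ultimately show ?thesis
    by unfold_locales (simp_all add: mpoly_subst_add)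
qed

end

definition mvar :: "nat \<Rightarrow> 'a::zero_neq_one mpoly" where
  "mvar i = Poly_Mapping.single (Poly_Mapping.single i 1) 1"

abbreviation mconst :: "'a::zero \<Rightarrow> 'a mpoly" where
  "mconst c \<equiv> Poly_Mapping.single 0 c"

lemma comm_ring_hom_mconst: "comm_ring_hom (mconst :: 'a::comm_ring_1 \<Rightarrow> 'a mpoly)"
  by unfold_locales (simp_all add: single_add mult_single)

lemma mpoly_eval_eq_subst: "mpoly_eval x = mpoly_subst id x"
  by (simp add: fun_eq_iff mpoly_eval_def mpoly_subst_def monom_val_def)

lemma mpoly_shift_eq_subst:
  "mpoly_shift \<beta> = mpoly_subst mconst (\<lambda>i. mvar i + mconst (\<beta> i))"
  by (simp add: fun_eq_iff mpoly_shift_def mpoly_subst_def monom_val_def mvar_def)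

lemma comm_ring_hom_id: "comm_ring_hom (id :: 'a::comm_ring_1 \<Rightarrow> 'a)"
  by unfold_locales simp_all

lemma comm_ring_hom_mpoly_eval: "comm_ring_hom (mpoly_eval x)"
  unfolding mpoly_eval_eq_subst by (rule comm_ring_hom.comm_ring_hom_mpoly_subst[OF comm_ring_hom_id])

lemma mpoly_eval_mvar [simp]: "mpoly_eval x (mvar i) = x i"
  by (simp only: mvar_def mpoly_eval_eq_subst comm_ring_hom.mpoly_subst_single[OF comm_ring_hom_id]
      id_apply monom_val_var mult_1)

lemma comm_ring_hom_mpoly_shift: "comm_ring_hom (mpoly_shift \<beta>)"
  unfolding mpoly_shift_eq_subst
  by (rule comm_ring_hom.comm_ring_hom_mpoly_subst[OF comm_ring_hom_mconst])

lemma mpoly_shift_mvar [simp]: "mpoly_shift \<beta> (mvar i) = mvar i + mconst (\<beta> i)"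
  unfolding mpoly_shift_eq_subst mvar_def comm_ring_hom.mpoly_subst_single[OF comm_ring_hom_mconst]
    monom_val_var single_one mult_1 ..

lemma map_of_int_mvar [simp]: "Poly_Mapping.map of_int (mvar i) = mvar i"
  by (simp add: mvar_def)

lemma keys_mvar [simp]: "Poly_Mapping.keys (mvar i) = {Poly_Mapping.single i 1}"
  by (simp add: mvar_def)

subsection \<open>Degrees of determinants\<close>

lemma mdeg_superset:
  assumes "finite S" "Poly_Mapping.keys m \<subseteq> S"
  shows "mdeg m = (\<Sum>i\<in>S. Poly_Mapping.lookup m i)"
  unfolding mdeg_def by (rule sum.mono_neutral_left) (use assms in \<open>auto simp: in_keys_iff\<close>)

lemma mdeg_add: "mdeg (a + b) = mdeg a + mdeg b"
  using Poly_Mapping.keys_add[of a b]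
  by (simp add: mdeg_superset[of "Poly_Mapping.keys a \<union> Poly_Mapping.keys b"] lookup_add sum.distrib)

lemma mdeg_0 [simp]: "mdeg 0 = 0"
  by (simp add: mdeg_def)

lemma mdeg_single [simp]: "mdeg (Poly_Mapping.single i e) = e"
  by (simp add: mdeg_def)

lemma keys_sum_subset:
  fixes f :: "'i \<Rightarrow> 'a \<Rightarrow>\<^sub>0 'b::comm_monoid_add"
  shows "Poly_Mapping.keys (sum f I) \<subseteq> (\<Union>i\<in>I. Poly_Mapping.keys (f i))"
proof (induction I rule: infinite_finite_induct)
  case (insert i I)
  then show ?case using Poly_Mapping.keys_add[of "f i" "sum f I"] by auto
qed simp_all

text \<open>\<open>G\<close> stays abstract to serve two gradings: exact degree with restricted
  variables, for homogeneity, and a lower bound on the degree, for vanishing.\<close>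

lemma keys_prod_graded:
  fixes f :: "'i \<Rightarrow> 'm::comm_monoid_add \<Rightarrow>\<^sub>0 'b::comm_semiring_1" and G :: "nat \<Rightarrow> 'm set"
  assumes "0 \<in> G 0" and "\<And>a b x y. x \<in> G a \<Longrightarrow> y \<in> G b \<Longrightarrow> x + y \<in> G (a + b)"
    and "finite I" and "\<And>i. i \<in> I \<Longrightarrow> Poly_Mapping.keys (f i) \<subseteq> G (d i)"
  shows "Poly_Mapping.keys (prod f I) \<subseteq> G (sum d I)"
  using assms(3,4)
proof (induction I rule: finite_induct)
  case empty
  then show ?case using assms(1) by simp
next
  case (insert i I)
  have "m \<in> G (d i + sum d I)" if m: "m \<in> Poly_Mapping.keys (f i * prod f I)" for m
  proof -
    obtain a b where "m = a + b" "a \<in> Poly_Mapping.keys (f i)" "b \<in> Poly_Mapping.keys (prod f I)"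
      using m Poly_Mapping.keys_mult by blast
    then show ?thesis using insert assms(2) by blast
  qed
  then show ?case using insert(1,2) by auto
qed

lemma keys_signof_mult:
  "Poly_Mapping.keys (signof \<pi> * p) = Poly_Mapping.keys (p :: 'm::comm_monoid_add \<Rightarrow>\<^sub>0 'b::comm_ring_1)"
  by (auto simp: sign_def in_keys_iff)

text \<open>Cancellation only removes monomials, so each one left occurs in some Leibniz term, where
  the degrees \<open>d i j\<close> add up.\<close>

lemma keys_det_graded:
  fixes A :: "('m::comm_monoid_add \<Rightarrow>\<^sub>0 'b::comm_ring_1) mat" and G :: "nat \<Rightarrow> 'm set"
  assumes A: "A \<in> carrier_mat n n"
    and G: "0 \<in> G 0" "\<And>a b x y. x \<in> G a \<Longrightarrow> y \<in> G b \<Longrightarrow> x + y \<in> G (a + b)"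
    and entries: "\<And>i j. i < n \<Longrightarrow> j < n \<Longrightarrow> Poly_Mapping.keys (A $$ (i, j)) \<subseteq> G (d i j)"
    and m: "m \<in> Poly_Mapping.keys (det A)"
  obtains \<pi> where "\<pi> permutes {0..<n}" "m \<in> G (\<Sum>i\<in>{0..<n}. d i (\<pi> i))"
proof -
  from m obtain \<pi> where \<pi>: "\<pi> permutes {0..<n}"
    and m': "m \<in> Poly_Mapping.keys (\<Prod>i\<in>{0..<n}. A $$ (i, \<pi> i))"
    unfolding det_def'[OF A] by (auto dest!: subsetD[OF keys_sum_subset] simp: keys_signof_mult)
  have "Poly_Mapping.keys (\<Prod>i\<in>{0..<n}. A $$ (i, \<pi> i)) \<subseteq> G (\<Sum>i\<in>{0..<n}. d i (\<pi> i))"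
  proof (rule keys_prod_graded[where G = G, OF G])
    fix i assume "i \<in> {0..<n}"
    then have "i < n" "\<pi> i < n" using permutes_in_image[OF \<pi>, of i] by simp_all
    then show "Poly_Mapping.keys (A $$ (i, \<pi> i)) \<subseteq> G (d i (\<pi> i))" by (rule entries)
  qed simp_all
  then have "m \<in> G (\<Sum>i\<in>{0..<n}. d i (\<pi> i))" using m' by (rule subsetD)
  then show thesis by (rule that[OF \<pi>])
qed

text \<open>Schur complement: a unit lower triangular block factor on the right clears
  \<open>W\<close> and leaves \<open>X + U * W\<close> in the upper left.\<close>

lemma det_add_mult_eq:
  fixes X :: "'a::idom mat"
  assumes X: "X \<in> carrier_mat n n" and U: "U \<in> carrier_mat n q" and W: "W \<in> carrier_mat q n"
  shows "det (X + U * W) = det (four_block_mat X (- U) W (1\<^sub>m q))"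
proof -
  let ?B = "four_block_mat X (- U) W (1\<^sub>m q)" and ?L = "four_block_mat (1\<^sub>m n) (0\<^sub>m n q) (- W) (1\<^sub>m q)"
  have "?B * ?L = four_block_mat (X * 1\<^sub>m n + - U * - W) (X * 0\<^sub>m n q + - U * 1\<^sub>m q)
      (W * 1\<^sub>m n + 1\<^sub>m q * - W) (W * 0\<^sub>m n q + 1\<^sub>m q * 1\<^sub>m q)"
    by (rule mult_four_block_mat) (use assms in auto)
  also have "\<dots> = four_block_mat (X + U * W) (- U) (0\<^sub>m q n) (1\<^sub>m q)"
    using assms by (intro cong_four_block_mat) (auto simp: minus_mult_minus)
  finally have eq: "?B * ?L = four_block_mat (X + U * W) (- U) (0\<^sub>m q n) (1\<^sub>m q)" .
  have "det ?B * det ?L = det (?B * ?L)"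
    by (rule det_mult[symmetric, of _ "n + q"]) (use assms in auto)
  also have "\<dots> = det (X + U * W) * det (1\<^sub>m q)"
    unfolding eq by (rule det_four_block_mat_lower_left_zero) (use assms in auto)
  finally have "det ?B * det ?L = det (X + U * W)" by simp
  moreover have "det ?L = det (1\<^sub>m n) * det (1\<^sub>m q)"
    by (rule det_four_block_mat_upper_right_zero) (use assms in auto)
  ultimately show ?thesis by simp
qed

text \<open>The rows \<open>i < n\<close> sent to columns \<open>\<ge> n\<close> inject into the
  \<open>q\<close> columns there; the sum counts the remaining rows below \<open>n\<close>.\<close>

lemma permutes_card_upper_left:
  fixes n q :: nat
  assumes "\<pi> permutes {0..<n + q}"
  shows "n \<le> q + (\<Sum>i\<in>{0..<n + q}. if i < n \<and> \<pi> i < n then 1 else 0)"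
proof -
  let ?S = "{i \<in> {0..<n}. \<pi> i < n}" and ?T = "{i \<in> {0..<n}. n \<le> \<pi> i}"
  have "card ?T \<le> card {n..<n + q}"
  proof (rule card_inj_on_le[of \<pi>])
    show "inj_on \<pi> ?T" by (rule permutes_inj_on[OF assms])
    show "\<pi> ` ?T \<subseteq> {n..<n + q}"
    proof safe
      fix i assume "i \<in> {0..<n}" "n \<le> \<pi> i"
      then show "\<pi> i \<in> {n..<n + q}" using permutes_in_image[OF assms, of i] by auto
    qed
  qed simp
  moreover have "card {0..<n} = card ?S + card ?T"
    by (subst card_Un_disjoint[symmetric]) (auto intro!: arg_cong[of _ _ card] simp del: card_atLeastLessThan)
  moreover have "(\<Sum>i\<in>{0..<n + q}. if i < n \<and> \<pi> i < n then 1 else 0 :: nat)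
      = card {i \<in> {0..<n + q}. i < n \<and> \<pi> i < n}"
    by (simp add: sum.If_cases Int_def)
  moreover have "{i \<in> {0..<n + q}. i < n \<and> \<pi> i < n} = ?S" by auto
  ultimately show ?thesis by simp
qed

text \<open>In the Leibniz expansion of the block determinant of \<open>det_add_mult_eq\<close>, at most \<open>q\<close> of the first
  \<open>n\<close> rows can pick an entry outside \<open>X\<close>.\<close>

lemma mdeg_det_low_rank:
  fixes X :: "'a::idom mpoly mat" and U W :: "'a mat"
  assumes X: "X \<in> carrier_mat n n" and U: "U \<in> carrier_mat n q" and W: "W \<in> carrier_mat q n"
    and entries: "\<And>i j m. i < n \<Longrightarrow> j < n \<Longrightarrow> m \<in> Poly_Mapping.keys (X $$ (i, j)) \<Longrightarrow> 1 \<le> mdeg m"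
    and m: "m \<in> Poly_Mapping.keys (det (X + map_mat mconst (U * W)))"
  shows "n \<le> q + mdeg m"
proof -
  interpret mconst: comm_ring_hom "mconst :: 'a \<Rightarrow> 'a mpoly" by (rule comm_ring_hom_mconst)
  let ?c = "map_mat mconst :: 'a mat \<Rightarrow> 'a mpoly mat"
  let ?B = "four_block_mat X (- ?c U) (?c W) (1\<^sub>m q)"
  let ?d = "\<lambda>i j. if i < n \<and> j < n then 1 else 0 :: nat"
  have "?c (U * W) = ?c U * ?c W"
    by (rule mconst.mat_hom_mult[OF U W])
  then have m': "m \<in> Poly_Mapping.keys (det ?B)"
    using m det_add_mult_eq[OF X, of "?c U" q "?c W"] U W by simp
  have B: "?B \<in> carrier_mat (n + q) (n + q)"
    by (rule four_block_carrier_mat) (use X in auto)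
  \<comment> \<open>Entries of \<open>X\<close> get weight 1 and constant blocks weight 0; only
    lower bounds on the degree are tracked.\<close>
  have "Poly_Mapping.keys (?B $$ (i, j)) \<subseteq> {m. ?d i j \<le> mdeg m}"
    if "i < n + q" "j < n + q" for i j
    using entries[of i j] that X U W by auto
  then obtain \<pi> where "\<pi> permutes {0..<n + q}" "m \<in> {m. (\<Sum>i\<in>{0..<n + q}. ?d i (\<pi> i)) \<le> mdeg m}"
    by (rule keys_det_graded[OF B, where G = "\<lambda>k. {m. k \<le> mdeg m}" and m = m, OF _ _ _ m', rotated 2])
      (auto simp: mdeg_add)
  then show ?thesis using permutes_card_upper_left[of \<pi> n q] by simp
qed

subsection \<open>Rank factorizations\<close>

text \<open>A maximal independent set of columns spans all columns: \<open>u\<close> holds its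
  vectors, \<open>w\<close> the coordinates of each column.\<close>

lemma rank_factorization:
  fixes M :: "'a::field mat"
  assumes M: "M \<in> carrier_mat n nc" and rank: "vec_space.rank n M \<le> q"
  obtains u w where "\<And>i j. i < n \<Longrightarrow> j < nc \<Longrightarrow> M $$ (i, j) = (\<Sum>x<q. u i x * w x j)"
proof -
  interpret vec_space "TYPE('a)" n .
  let ?P = "\<lambda>T. T \<subseteq> set (cols M) \<and> lin_indpt T"
  have "?P {}" by (simp add: finite_lin_indpt2)
  then obtain S where max: "maximal S ?P" and "finite S"
    using maximal_exists_superset[of "set (cols M)" ?P "{}"] by blast
  have cols: "set (cols M) \<subseteq> carrier_vec n" using M cols_dim by blast
  have S: "S \<subseteq> set (cols M)" "lin_indpt S" using max by (auto simp: maximal_def)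
  have Sc: "S \<subseteq> carrier_vec n" using S cols by blast
  have card: "card S \<le> q" using rank rank_card_indpt[OF M max] by simp
  have "v \<in> span S" if v: "v \<in> set (cols M)" for v
  proof (rule ccontr)
    assume nspan: "v \<notin> span S"
    then have "v \<notin> S" using span_mem[OF Sc] by blast
    moreover have "lin_indpt (S \<union> {v})"
      using lin_dep_iff_in_span[OF Sc S(2) _ \<open>v \<notin> S\<close>] nspan v cols by blast
    ultimately show False using max S(1) v unfolding maximal_def by blast
  qed
  then have "\<forall>v\<in>set (cols M). \<exists>a. v = lincomb a S"
    using finite_span[OF \<open>finite S\<close> Sc] by blast
  then obtain a where a: "\<And>v. v \<in> set (cols M) \<Longrightarrow> v = lincomb (a v) S"
    by metis
  obtain h where h: "bij_betw h {0..<card S} S"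
    using ex_bij_betw_nat_finite[OF \<open>finite S\<close>] by blast
  \<comment> \<open>Zero padding from \<open>card S\<close> up to \<open>q\<close> allows for a rank
    smaller than \<open>q\<close>.\<close>
  define u where "u i x = (if x < card S then h x $ i else 0)" for i x
  define w where "w x j = a (col M j) (h x)" for x j
  have "M $$ (i, j) = (\<Sum>x<q. u i x * w x j)" if ij: "i < n" "j < nc" for i j
  proof -
    have "col M j \<in> set (cols M)" using ij M by (simp add: cols_def)
    then have "M $$ (i, j) = lincomb (a (col M j)) S $ i"
      using a[of "col M j"] ij M by (metis carrier_matD index_col)
    also have "\<dots> = (\<Sum>v\<in>S. v $ i * a (col M j) v)"
      by (simp add: lincomb_index[OF ij(1) Sc] mult.commute)
    also have "\<dots> = (\<Sum>x\<in>{0..<card S}. u i x * w x j)"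
      unfolding u_def w_def by (subst sum.reindex_bij_betw[OF h, symmetric]) simp
    also have "\<dots> = (\<Sum>x<q. u i x * w x j)"
      by (rule sum.mono_neutral_left) (use card in \<open>auto simp: u_def\<close>)
    finally show ?thesis .
  qed
  then show thesis using that by blast
qed

lemma sum_factorization_mat:
  fixes u :: "nat \<Rightarrow> 's \<Rightarrow> 'a::comm_semiring_0"
  assumes "finite S"
  obtains U W where "U \<in> carrier_mat n (card S)" "W \<in> carrier_mat (card S) m"
    "U * W = mat n m (\<lambda>(i, j). \<Sum>s\<in>S. u i s * w s j)"
proof -
  obtain h where h: "bij_betw h {0..<card S} S"
    using ex_bij_betw_nat_finite[OF assms] by blast
  let ?U = "mat n (card S) (\<lambda>(i, x). u i (h x))" and ?W = "mat (card S) m (\<lambda>(x, j). w (h x) j)"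
  have "?U * ?W = mat n m (\<lambda>(i, j). \<Sum>s\<in>S. u i s * w s j)"
    by (rule eq_matI) (simp_all add: scalar_prod_def sum.reindex_bij_betw[OF h, symmetric])
  then show thesis by (intro that[of ?U ?W]) simp_all
qed

text \<open>A multiset encodes a monomial in \<open>q\<close> variables, with multiplicities as
  exponents.\<close>

definition bounded_msets :: "nat \<Rightarrow> nat \<Rightarrow> nat multiset set" where
  "bounded_msets q l = {s. set_mset s \<subseteq> {..<q} \<and> size s \<le> l}"

lemma size_eq_sum_count: "set_mset (s :: nat multiset) \<subseteq> {..<q} \<Longrightarrow> size s = (\<Sum>x<q. count s x)"
  unfolding size_multiset_overloaded_eq
  by (rule sum.mono_neutral_left) (auto simp: count_eq_zero_iff)

text \<open>Stars and bars, through an injection into the lists of \<open>q + 1\<close> naturals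
  with sum \<open>l\<close>.\<close>

lemma bounded_msets_finite_card:
  shows finite_bounded_msets: "finite (bounded_msets q l)"
    and card_bounded_msets: "card (bounded_msets q l) \<le> (q + l) choose l"
proof -
  let ?T = "{xs :: nat list. length xs = Suc q \<and> sum_list xs = l}"
  \<comment> \<open>The first entry is the slack variable that homogenizes the degree.\<close>
  let ?h = "\<lambda>s. (l - size s) # map (count s) [0..<q]"
  have "?T \<subseteq> {xs. set xs \<subseteq> {..l} \<and> length xs = Suc q}"
    using member_le_sum_list by fastforce
  then have fin: "finite ?T" by (rule finite_subset) (simp add: finite_lists_length_eq)
  have inj: "inj_on ?h (bounded_msets q l)"
  proof (rule inj_onI, rule multiset_eqI)
    fix s t x assume "s \<in> bounded_msets q l" "t \<in> bounded_msets q l" "?h s = ?h t"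
    then show "count s x = count t x"
      by (cases "x < q") (auto simp: bounded_msets_def, (metis count_inI lessThan_iff subsetD)+)
  qed
  have img: "?h ` bounded_msets q l \<subseteq> ?T"
    by (auto simp: bounded_msets_def interv_sum_list_conv_sum_set_nat size_eq_sum_count atLeast0LessThan)
  show "finite (bounded_msets q l)" using inj_on_finite[OF inj img fin] .
  have "card (bounded_msets q l) \<le> card ?T" by (rule card_inj_on_le[OF inj img fin])
  then show "card (bounded_msets q l) \<le> (q + l) choose l"
    by (simp add: card_length_sum_list add.commute)
qed

text \<open>Multinomial expansion by induction on \<open>d\<close>, with implicit coefficients. It
  matters that \<open>c\<close> is chosen before \<open>y\<close>, since \<open>y\<close> will vary
  with the matrix entry.\<close>

lemma power_sum_eq_sum_msets:
  obtains c :: "nat multiset \<Rightarrow> 'a::comm_semiring_1" where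
    "\<And>y d. d \<le> l \<Longrightarrow> (\<Sum>x<q. y x) ^ d
      = (\<Sum>s | s \<in> bounded_msets q l \<and> size s = d. c s * (\<Prod>x\<in>#s. y x))"
proof -
  let ?B = "\<lambda>d. {s. s \<in> bounded_msets q l \<and> size s = d}"
  have fin: "finite (?B d)" for d
    using finite_bounded_msets[of q l] by simp
  have "\<exists>c :: nat multiset \<Rightarrow> 'a. \<forall>y. (\<Sum>x<q. y x) ^ d = (\<Sum>s\<in>?B d. c s * (\<Prod>x\<in>#s. y x))" if "d \<le> l" for d
    using that
  proof (induction d)
    case 0
    have "?B 0 = {{#}}" by (auto simp: bounded_msets_def)
    then show ?case by (intro exI[of _ "\<lambda>_. 1"]) simp
  next
    case (Suc d)
    then obtain c :: "nat multiset \<Rightarrow> 'a"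
      where c: "\<And>y. (\<Sum>x<q. y x) ^ d = (\<Sum>s\<in>?B d. c s * (\<Prod>x\<in>#s. y x))" by auto
    let ?g = "\<lambda>(x, s). add_mset x s" and ?S = "{..<q} \<times> ?B d"
    \<comment> \<open>Several pairs \<open>(x, s)\<close> can give the same multiset
      \<open>t\<close>; their coefficients are added.\<close>
    define c' where "c' t = (\<Sum>p\<in>{p \<in> ?S. ?g p = t}. c (snd p))" for t
    have "(\<Sum>x<q. y x) ^ Suc d = (\<Sum>s\<in>?B (Suc d). c' s * (\<Prod>x\<in>#s. y x))" for y
    proof -
      have "(\<Sum>x<q. y x) ^ Suc d = (\<Sum>x<q. y x) * (\<Sum>s\<in>?B d. c s * (\<Prod>x\<in>#s. y x))"
        by (simp add: c)
      also have "\<dots> = (\<Sum>p\<in>?S. c (snd p) * (\<Prod>x\<in>#?g p. y x))"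
        by (simp add: sum_product sum.cartesian_product case_prod_beta ac_simps)
      also have "\<dots> = (\<Sum>t\<in>?B (Suc d). \<Sum>p\<in>{p \<in> ?S. ?g p = t}. c (snd p) * (\<Prod>x\<in>#?g p. y x))"
        by (rule sum.group[symmetric]) (use fin Suc.prems in \<open>auto simp: bounded_msets_def\<close>)
      also have "\<dots> = (\<Sum>t\<in>?B (Suc d). c' t * (\<Prod>x\<in>#t. y x))"
        unfolding c'_def sum_distrib_right by (intro sum.cong refl) auto
      finally show ?thesis .
    qed
    then show ?case by blast
  qed
  then obtain c :: "nat \<Rightarrow> nat multiset \<Rightarrow> 'a" where
    c: "\<And>d y. d \<le> l \<Longrightarrow> (\<Sum>x<q. y x) ^ d = (\<Sum>s\<in>?B d. c d s * (\<Prod>x\<in>#s. y x))"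
    by metis
  \<comment> \<open>The size of \<open>s\<close> determines \<open>d\<close>, so the coefficient
    families for all \<open>d\<close> merge into one.\<close>
  show thesis
    by (rule that[of "\<lambda>s. c (size s) s"]) (auto simp: c intro!: sum.cong)
qed

lemma poly_sum_eq_sum_msets:
  obtains c :: "nat multiset \<Rightarrow> 'a::comm_ring_1" where
    "\<And>f y. degree f \<le> l \<Longrightarrow> poly f (\<Sum>x<q. y x)
      = (\<Sum>s\<in>bounded_msets q l. coeff f (size s) * c s * (\<Prod>x\<in>#s. y x))"
proof -
  obtain c :: "nat multiset \<Rightarrow> 'a" where c: "\<And>y d. d \<le> l \<Longrightarrow> (\<Sum>x<q. y x) ^ d
      = (\<Sum>s | s \<in> bounded_msets q l \<and> size s = d. c s * (\<Prod>x\<in>#s. y x))"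
    using power_sum_eq_sum_msets by blast
  have "poly f (\<Sum>x<q. y x) = (\<Sum>s\<in>bounded_msets q l. coeff f (size s) * c s * (\<Prod>x\<in>#s. y x))"
    if f: "degree f \<le> l" for f y
  proof -
    have "poly f (\<Sum>x<q. y x) = (\<Sum>d\<le>l. coeff f d * (\<Sum>x<q. y x) ^ d)"
      unfolding poly_altdef by (rule sum.mono_neutral_left) (use f in \<open>auto simp: coeff_eq_0\<close>)
    also have "\<dots> = (\<Sum>d\<le>l. \<Sum>s\<in>{s \<in> bounded_msets q l. size s = d}.
        coeff f (size s) * c s * (\<Prod>x\<in>#s. y x))"
      by (intro sum.cong refl) (simp add: c sum_distrib_left mult.assoc)
    also have "\<dots> = (\<Sum>s\<in>bounded_msets q l. coeff f (size s) * c s * (\<Prod>x\<in>#s. y x))"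
      by (rule sum.group) (auto simp: finite_bounded_msets, simp add: bounded_msets_def)
    finally show ?thesis .
  qed
  then show thesis using that by blast
qed

subsection \<open>The determinant polynomial\<close>

text \<open>A triangular factorization gives the value. The corner 1 matters: with 0 there the
  determinant would be \<open>m\<close> up to sign.\<close>

lemma det_ones_minus_diag:
  "det (mat (Suc m) (Suc m) (\<lambda>(i, j). if i = j \<and> i \<noteq> m then 0 else 1)) = (-1 :: 'a::comm_ring_1) ^ m"
proof -
  let ?n = "Suc m"
  let ?T = "mat ?n ?n (\<lambda>(i, j). if i = j \<and> i \<noteq> m then -1 else if j = m then 1 else 0) :: 'a mat"
  let ?C = "mat ?n ?n (\<lambda>(i, j). if i = j \<or> i = m then 1 else 0) :: 'a mat"
  \<comment> \<open>For \<open>i < m\<close>, row \<open>i\<close> is the all-ones last row minus a unit vector.\<close>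
  have "mat ?n ?n (\<lambda>(i, j). if i = j \<and> i \<noteq> m then 0 else 1) = ?T * ?C"
  proof (rule eq_matI)
    fix i j assume "i < dim_row (?T * ?C)" "j < dim_col (?T * ?C)"
    then have ij: "i < ?n" "j < ?n" by simp_all
    have "(?T * ?C) $$ (i, j) = (\<Sum>k\<in>{0..<?n}. ?T $$ (i, k) * ?C $$ (k, j))"
      using ij by (simp add: scalar_prod_def)
    also have "\<dots> = (\<Sum>k\<in>{0..<m}. if k = i then - (if k = j then 1 else 0) else 0) + 1"
      unfolding sum.atLeast0_lessThan_Suc
      by (intro arg_cong2[of _ _ _ _ "(+)"] sum.cong) (use ij in auto)
    also have "\<dots> = (if i = j \<and> i \<noteq> m then 0 else 1)"
      using ij by auto
    finally show "mat ?n ?n (\<lambda>(i, j). if i = j \<and> i \<noteq> m then 0 else 1) $$ (i, j) = (?T * ?C) $$ (i, j)"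
      using ij by simp
  qed simp_all
  moreover have "det ?T = (-1) ^ m"
  proof -
    have "det ?T = prod_list (diag_mat ?T)"
      by (rule det_upper_triangular) (auto simp: upper_triangular_def)
    then show ?thesis by (simp add: prod_list_diag_prod)
  qed
  moreover have "det ?C = 1"
  proof -
    have "det ?C = prod_list (diag_mat ?C)"
      by (rule det_lower_triangular[of ?n]) auto
    then show ?thesis by (simp add: prod_list_diag_prod)
  qed
  ultimately show ?thesis by (simp add: det_mult[of _ ?n])
qed

text \<open>If all sizes were below \<open>n\<close>, the supremum would be at most
  \<open>n - 1\<close>. As \<open>N\<close> may exceed \<open>n\<close> or be infinite, the size
  found may be larger than \<open>n\<close>.\<close>

lemma ex_large_L_matrix_size:
  assumes "n > 0" "enat n \<le> N r L"
  obtains n' where "n \<le> n'" "n' \<in> L_matrix_sizes r L"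
proof (rule ccontr)
  assume "\<not> thesis"
  then have "N r L \<le> enat (n - 1)"
    unfolding N_def
  proof (intro SUP_least)
    fix i assume "i \<in> L_matrix_sizes r L"
    then have "\<not> n \<le> i" using that \<open>\<not> thesis\<close> by blast
    then show "enat i \<le> enat (n - 1)" by simp
  qed
  with assms(2) have "enat n \<le> enat (n - 1)" by (rule order_trans)
  then show False using assms(1) by simp
qed

lemma keys_minus_one_power_mult:
  "Poly_Mapping.keys ((-1) ^ k * p) = Poly_Mapping.keys (p :: 'm::comm_monoid_add \<Rightarrow>\<^sub>0 'b::comm_ring_1)"
  by (cases "even k") (auto simp: in_keys_iff)

text \<open>In the products \<open>u i x * w x j\<close> every monomial splits into a factor in
  \<open>i\<close> and a factor in \<open>j\<close>, so each multiset costs one unit of inner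
  dimension.\<close>

lemma polynomial_kernel_factorization:
  fixes f :: "'a::field poly" and u w :: "nat \<Rightarrow> nat \<Rightarrow> 'a"
  assumes f: "degree f \<le> l" "poly f 0 = 0"
  obtains s U W where "s \<le> (q + l) choose l" "U \<in> carrier_mat n s" "W \<in> carrier_mat s n"
    "U * W = mat n n (\<lambda>(i, j). poly f (\<Sum>x<q. u i x * w x j) + a i * b j)"
proof -
  obtain c :: "nat multiset \<Rightarrow> 'a" where c: "\<And>f y. degree f \<le> l \<Longrightarrow> poly f (\<Sum>x<q. y x)
      = (\<Sum>s\<in>bounded_msets q l. coeff f (size s) * c s * (\<Prod>x\<in>#s. y x))"
    using poly_sum_eq_sum_msets by blast
  \<comment> \<open>The slot of \<open>{#}\<close>, with coefficient \<open>f 0 = 0\<close>, is free to carry the rank one term.\<close>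
  define u' where "u' i s = (if s = {#} then a i else coeff f (size s) * c s * (\<Prod>x\<in>#s. u i x))" for i s
  define w' where "w' s j = (if s = {#} then b j else (\<Prod>x\<in>#s. w x j))" for s j
  let ?S = "bounded_msets q l"
  have S: "finite ?S" "{#} \<in> ?S"
    by (rule finite_bounded_msets) (simp add: bounded_msets_def)
  have "coeff f 0 = 0" using f(2) by (simp add: poly_0_coeff_0)
  then have "poly f (\<Sum>x<q. u i x * w x j) + a i * b j = (\<Sum>s\<in>?S. u' i s * w' s j)" for i j
    by (simp add: c[OF f(1)] sum.remove[OF S] u'_def w'_def prod_mset.distrib mult.assoc)
  moreover obtain U W where "U \<in> carrier_mat n (card ?S)" "W \<in> carrier_mat (card ?S) n"
    "U * W = mat n n (\<lambda>(i, j). \<Sum>s\<in>?S. u' i s * w' s j)"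
    by (rule sum_factorization_mat[OF S(1)])
  ultimately show thesis using that[OF card_bounded_msets] by simp
qed

theorem theorem9:
  fixes L :: "'a::field set" and \<alpha> :: "nat \<Rightarrow> 'a" and k r l v :: nat
  assumes "inj_on \<alpha> {1..k}" and "L = \<alpha> ` {1..k}" and "0 \<notin> L"
    and "r > 0" and "l > 0" and "v > 0"
    and "N (r - 1) L \<ge> enat ((r + l - 1 choose l) + v)"
  shows "\<exists>P :: int mpoly.
    mpoly_vars P \<subseteq> {1..k} \<and> homogeneous P \<and>
    mpoly_eval (\<lambda>_. 1) P = 1 \<and>
    (\<forall>f :: 'a poly. degree f \<le> l \<and> poly f 0 = 0 \<longrightarrow>
       vanishes_to_order v (\<lambda>i. poly f (\<alpha> i)) (Poly_Mapping.map of_int P)) \<and>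
    total_deg P \<le> (r + l - 1 choose l) + v"
proof -
  have "(r + l - 1) choose l > 0" using assms(4) by simp
  moreover obtain n0 where n: "(r + l - 1 choose l) + v = Suc n0"
    using assms(6) by (cases "(r + l - 1 choose l) + v") auto
  ultimately have "n0 > 0" using assms(6) by linarith
  let ?n = "Suc n0"
  obtain n' M where n': "?n \<le> n'" and M: "L_matrix L n' M" and rank: "vec_space.rank n' M \<le> r - 1"
  proof (rule ex_large_L_matrix_size)
    show "enat ?n \<le> N (r - 1) L" using assms(7) n by simp
  qed (auto simp: L_matrix_sizes_def)
  have Mc: "M \<in> carrier_mat n' n'" using M by (simp add: L_matrix_def)
  \<comment> \<open>All of \<open>M\<close> is factorized; its leading \<open>?n\<close> by
    \<open>?n\<close> block inherits this by restricting the indices.\<close>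
  obtain u w where uw: "\<And>i j. i < n' \<Longrightarrow> j < n' \<Longrightarrow> M $$ (i, j) = (\<Sum>x<r - 1. u i x * w x j)"
    using rank_factorization[OF Mc rank] by blast
  have "\<exists>c\<in>{1..k}. M $$ (i, j) = \<alpha> c" if "i < ?n" "j < ?n" "i \<noteq> j" for i j
    using M that n' assms(2) by (auto simp: L_matrix_def image_iff)
  then obtain idx where idx: "\<And>i j. i < ?n \<Longrightarrow> j < ?n \<Longrightarrow> i \<noteq> j \<Longrightarrow> idx i j \<in> {1..k}"
    "\<And>i j. i < ?n \<Longrightarrow> j < ?n \<Longrightarrow> i \<noteq> j \<Longrightarrow> M $$ (i, j) = \<alpha> (idx i j)"
    by metis
  \<comment> \<open>The corner variable \<open>mvar 1\<close> must be one of the \<open>k\<close>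
    variables; the off-diagonal position \<open>(0, 1)\<close> shows that there is one.\<close>
  have k: "1 \<in> {1..k}" using idx(1)[of 0 1] \<open>n0 > 0\<close> by simp
  let ?e = "\<lambda>i j. if i = j then if i = n0 then mvar 1 else 0 else mvar (idx i j)"
  let ?A = "mat ?n ?n (\<lambda>(i, j). ?e i j) :: int mpoly mat"
  \<comment> \<open>The sign makes the value at the all-ones point \<open>1\<close> instead of
    \<open>(-1) ^ n0\<close>.\<close>
  define P where "P = (-1) ^ n0 * det ?A"
  have keys: "mdeg m = ?n \<and> Poly_Mapping.keys m \<subseteq> {1..k}" if "m \<in> Poly_Mapping.keys P" for m
  proof -
    \<comment> \<open>Zero entries have no monomials, so they too count as having degree 1.\<close>
    let ?G = "\<lambda>d. {m. mdeg m = d \<and> Poly_Mapping.keys m \<subseteq> {1..k}}"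
    have m: "m \<in> Poly_Mapping.keys (det ?A)"
      using that by (simp add: P_def keys_minus_one_power_mult)
    have "x + y \<in> ?G (a + b)" if "x \<in> ?G a" "y \<in> ?G b" for a b x y
      using that Poly_Mapping.keys_add[of x y] by (auto simp: mdeg_add)
    moreover have "Poly_Mapping.keys (?A $$ (i, j)) \<subseteq> ?G 1" if "i < ?n" "j < ?n" for i j
      using that idx(1)[of i j] k by auto
    ultimately obtain \<pi> where "m \<in> ?G (\<Sum>i\<in>{0..<?n}. 1)"
      by (rule keys_det_graded[where G = ?G and n = ?n, OF _ _ _ _ m, rotated 2]) auto
    then show ?thesis by simp
  qed
  have "mpoly_eval (\<lambda>_. 1) P = 1"
  proof -
    interpret ev: comm_ring_hom "mpoly_eval (\<lambda>_. 1) :: int mpoly \<Rightarrow> int"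
      by (rule comm_ring_hom_mpoly_eval)
    have "map_mat (mpoly_eval (\<lambda>_. 1)) ?A = mat ?n ?n (\<lambda>(i, j). if i = j \<and> i \<noteq> n0 then 0 else 1)"
      by (rule eq_matI) auto
    then have "mpoly_eval (\<lambda>_. 1) P = (-1) ^ n0 * (-1) ^ n0"
      unfolding P_def by (simp add: hom_distribs det_ones_minus_diag flip: ev.hom_det)
    then show ?thesis by (simp flip: power_mult_distrib)
  qed
  moreover have "vanishes_to_order v (\<lambda>i. poly f (\<alpha> i)) (Poly_Mapping.map of_int P)"
    if f: "degree f \<le> l" "poly f 0 = 0" for f :: "'a poly"
    unfolding vanishes_to_order_def
  proof (intro allI impI, rule ccontr)
    fix m
    let ?\<beta> = "\<lambda>i. poly f (\<alpha> i)"
    assume m: "mdeg m < v"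
      and "Poly_Mapping.lookup (mpoly_shift ?\<beta> (Poly_Mapping.map of_int P)) m \<noteq> 0"
    then have m_keys: "m \<in> Poly_Mapping.keys (mpoly_shift ?\<beta> (Poly_Mapping.map of_int P))"
      by (simp add: in_keys_iff)
    interpret ri: comm_ring_hom "Poly_Mapping.map of_int :: int mpoly \<Rightarrow> 'a mpoly"
      by (rule comm_ring_hom_map) unfold_locales
    interpret sh: comm_ring_hom "mpoly_shift ?\<beta>"
      by (rule comm_ring_hom_mpoly_shift)
    let ?H = "\<lambda>p. mpoly_shift ?\<beta> (Poly_Mapping.map of_int p)"
    let ?X = "mat ?n ?n (\<lambda>(i, j). ?e i j) :: 'a mpoly mat"
    \<comment> \<open>\<open>a i * b j\<close> is the value of the corner variable at
      \<open>(n0, n0)\<close> and 0 elsewhere.\<close>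
    define a where "a i = (if i = n0 then 1 else 0 :: 'a)" for i
    define b where "b j = (if j = n0 then ?\<beta> 1 else 0)" for j
    obtain s U W where s: "s \<le> (r - 1 + l) choose l" and UW: "U \<in> carrier_mat ?n s" "W \<in> carrier_mat s ?n"
      and UW_eq: "U * W = mat ?n ?n (\<lambda>(i, j). poly f (\<Sum>x<r - 1. u i x * w x j) + a i * b j)"
      by (rule polynomial_kernel_factorization[OF f])
    have UW_entry: "(U * W) $$ (i, j) = (if i = j then if i = n0 then ?\<beta> 1 else 0 else ?\<beta> (idx i j))"
      if "i < ?n" "j < ?n" for i j
    proof -
      have "(U * W) $$ (i, j) = poly f (M $$ (i, j)) + a i * b j"
        using that n' by (simp add: UW_eq uw)
      moreover have "M $$ (i, i) = 0" using M that n' by (simp add: L_matrix_def)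
      ultimately show ?thesis using that idx(2)[of i j] f(2) by (auto simp: a_def b_def)
    qed
    \<comment> \<open>The shift turns each variable into itself plus its value: \<open>?X\<close>
      collects the linear parts, \<open>U * W\<close> the constants.\<close>
    have "map_mat ?H ?A = ?X + map_mat mconst (U * W)"
      by (rule eq_matI) (use UW in \<open>auto simp: UW_entry simp del: index_mult_mat(1)\<close>)
    moreover have "?H P = (-1) ^ n0 * det (map_mat ?H ?A)"
    proof -
      have "det (map_mat ?H ?A) = det (map_mat (mpoly_shift ?\<beta>) (map_mat (Poly_Mapping.map of_int) ?A))"
        by (rule arg_cong[of _ _ det]) (rule eq_matI, simp_all)
      then show ?thesis
        unfolding P_def by (simp add: ri.hom_mult ri.hom_power sh.hom_mult sh.hom_power ri.hom_uminus sh.hom_uminus)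
    qed
    ultimately have "m \<in> Poly_Mapping.keys (det (?X + map_mat mconst (U * W)))"
      using m_keys by (simp add: keys_minus_one_power_mult)
    then have "?n \<le> s + mdeg m"
      by (rule mdeg_det_low_rank[OF _ UW, rotated 2]) (auto split: if_splits)
    \<comment> \<open>As \<open>r > 0\<close>, \<open>r - 1 + l\<close> equals
      \<open>r + l - 1\<close>, so \<open>s + mdeg m\<close> falls below \<open>?n\<close>.\<close>
    then show False using n m s assms(4) by simp
  qed
  moreover have "total_deg P \<le> ?n"
    unfolding total_deg_def using keys by (intro Max.boundedI) auto
  ultimately show ?thesis
    using keys n by (intro exI[of _ P]) (auto simp: mpoly_vars_def homogeneous_def)
qed

end
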